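(* Let $(S,\mathcal B(S))$ be a standard Borel space and let $(P_t)_{t\ge0}$ be a Markov semigroup on $S$. Assume that $(P_t)_{t\ge0}$ admits at least one invariant probability measure and that it is $\psi$-irreducible, that is, there exists a nonzero $\sigma$-finite measure $\psi$ on $(S,\mathcal B(S))$ such that for every $A\in\mathcal B(S)$ with $\psi(A)>0$ and every $x\in S$ there exists $t>0$ with $P_t(x,A)>0$. Assume moreover that for every $x\in S$ and every $A\in\mathcal B(S)$ the map $t\mapsto P_t(x,A)$ is right-continuous on $(0,\infty)$. Then the invariant probability measure of $(P_t)_{t\ge0}$ is unique.
   Context: A Markov semigroup $(P_t)_{t\ge0}$ on $S$ is a family of Markov transition kernels on $(S,\mathcal B(S))$ such that $P_0(x,\cdot)=\delta_x$ and $P_{t+s}(x,A)=\int_S P_t(y,A)\,P_s(x,dy)$ for all $t,s\ge0$, $x\in S$, $A\in\mathcal B(S)$. A probability measure $\mu$ on $(S,\mathcal B(S))$ is invariant for $(P_t)_{t\ge0}$ if $\mu P_t=\mu$ for all $t\ge0$, i.e. $\int_S P_t(x,A)\,\mu(dx)=\mu(A)$ for all $A\in\mathcal B(S)$ and all $t\ge0$. *)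

theory Defs
  imports "HOL-Probability.Probability"
begin

text \<open>The measurable space underlying \<open>M\<close> is standard Borel if its \<open>\<sigma>\<close>-algebra is generated by the
  open sets of some Polish topology on \<open>space M\<close>.  The measure carried by \<open>M\<close> plays no role, neither
  here nor below.\<close>

definition standard_borel :: "'a measure \<Rightarrow> bool" where
  "standard_borel M \<longleftrightarrow>
     (\<exists>X. completely_metrizable_space X \<and> separable_space X \<and> topspace X = space M \<and>
          sets M = sigma_sets (space M) {U. openin X U})"

text \<open>Time is \<open>real\<close>, and nothing is required of \<open>P t x\<close> for \<open>t < 0\<close> or \<open>x \<notin> space M\<close>.  The
  measurability of \<open>P t\<close> into \<^const>\<open>prob_algebra\<close> says that each \<open>P t x\<close> is a probability measure on
  \<open>sets M\<close> and that \<open>x \<mapsto> P t x A\<close> is measurable for every \<open>A \<in> sets M\<close>.\<close>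

definition markov_semigroup :: "'a measure \<Rightarrow> (real \<Rightarrow> 'a \<Rightarrow> 'a measure) \<Rightarrow> bool" where
  "markov_semigroup M P \<longleftrightarrow>
     (\<forall>t\<ge>0. P t \<in> M \<rightarrow>\<^sub>M prob_algebra M) \<and>
     (\<forall>x\<in>space M. P 0 x = return M x) \<and>
     (\<forall>t\<ge>0. \<forall>s\<ge>0. \<forall>x\<in>space M. \<forall>A\<in>sets M.
        emeasure (P (t + s) x) A = (\<integral>\<^sup>+ y. emeasure (P t y) A \<partial>P s x))"

definition invariant_prob :: "'a measure \<Rightarrow> (real \<Rightarrow> 'a \<Rightarrow> 'a measure) \<Rightarrow> 'a measure \<Rightarrow> bool" where
  "invariant_prob M P \<mu> \<longleftrightarrow>
     prob_space \<mu> \<and> sets \<mu> = sets M \<and>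
     (\<forall>t\<ge>0. \<forall>A\<in>sets M. (\<integral>\<^sup>+ x. emeasure (P t x) A \<partial>\<mu>) = emeasure \<mu> A)"

definition psi_irreducible :: "'a measure \<Rightarrow> (real \<Rightarrow> 'a \<Rightarrow> 'a measure) \<Rightarrow> bool" where
  "psi_irreducible M P \<longleftrightarrow>
     (\<exists>\<psi>. sigma_finite_measure \<psi> \<and> sets \<psi> = sets M \<and> emeasure \<psi> (space M) \<noteq> 0 \<and>
        (\<forall>A\<in>sets M. emeasure \<psi> A > 0 \<longrightarrow>
           (\<forall>x\<in>space M. \<exists>t>0. emeasure (P t x) A > 0)))"

end

theory Submission
  imports Defs
begin

text \<open>Write \<open>C\<close> for the complement of \<open>Y\<close>. Let \<open>\<mu>\<close> and \<open>\<nu>\<close> be invariant probability measures and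
  let \<open>Y\<close> be a Hahn set of \<open>\<mu> - \<nu>\<close>, so that \<open>\<nu> \<le> \<mu>\<close> on subsets of \<open>Y\<close> and \<open>\<mu> \<le> \<nu>\<close> on subsets of
  \<open>C\<close>. Invariance means that in time \<open>t\<close> as much mass flows from \<open>Y\<close> to \<open>C\<close> as from \<open>C\<close> to \<open>Y\<close>
  (\<open>invariant_flux_balance\<close>). By domination, the flux out of \<open>Y\<close> is at least as large under \<open>\<mu>\<close> as under \<open>\<nu>\<close>, and the
  flux into \<open>Y\<close> is at most as large; hence both measures have the same flux
  \<open>\<integral>\<^sub>C P t x Y\<close>, and the positive measure \<open>\<nu> - \<mu>\<close> on \<open>C\<close> does not charge
  \<open>{x. P t x Y > 0}\<close> (\<open>flux_into_dominating_set_eq\<close> and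
  \<open>measure_eq_of_le_of_positive_integrals_eq\<close>).

  The irreducibility measure \<open>\<psi>\<close> charges \<open>Y\<close> or \<open>C\<close>, and the situation is symmetric under exchanging
  \<open>\<mu>\<close> with \<open>\<nu>\<close> and \<open>Y\<close> with \<open>C\<close>, so let \<open>\<psi>\<close> charge \<open>Y\<close>. Then from every point \<open>Y\<close> is reached at
  some time with positive probability, and by right-continuity at some rational time. Thus the
  sets \<open>{x. P q x Y > 0}\<close> with \<open>q > 0\<close> rational, which are only countably many, cover the whole space. So
  \<open>\<nu> - \<mu>\<close> vanishes on \<open>C\<close>; as both measures have mass one, it vanishes on \<open>Y\<close> too.\<close>

section \<open>Finite measures that dominate one another\<close>

lemma nn_integral_add_measure:
  assumes sets_M [measurable_cong]: "sets M = sets N" and sets_D [measurable_cong]: "sets D = sets N"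
    and add: "\<And>A. A \<in> sets N \<Longrightarrow> emeasure N A = emeasure M A + emeasure D A"
    and h: "h \<in> borel_measurable N"
  shows "(\<integral>\<^sup>+x. h x \<partial>N) = (\<integral>\<^sup>+x. h x \<partial>M) + (\<integral>\<^sup>+x. h x \<partial>D)"
  using h
proof (induction rule: borel_measurable_induct)
  case (cong f g)
  then show ?case
    using nn_integral_cong[of M f g] nn_integral_cong[of D f g] nn_integral_cong[of N f g]
      sets_eq_imp_space_eq[OF sets_M] sets_eq_imp_space_eq[OF sets_D] by auto
next
  case (set A)
  then show ?case using add sets_M sets_D by simp
next
  case (mult u c)
  then show ?case
    by (simp add: nn_integral_cmult distrib_left measurable_cong_sets[OF sets_M refl]
        measurable_cong_sets[OF sets_D refl])
next
  case (add u v)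
  then show ?case
    by (simp add: nn_integral_add ac_simps measurable_cong_sets[OF sets_M refl]
        measurable_cong_sets[OF sets_D refl])
next
  case (seq U)
  have U: "U i \<in> borel_measurable M" "U i \<in> borel_measurable D" "U i \<in> borel_measurable N" for i
    using seq.hyps(1)[of i] by measurable
  have mono: "incseq (\<lambda>i. integral\<^sup>N K (U i))" for K
    using seq.hyps by (auto simp: incseq_def le_fun_def intro!: nn_integral_mono)
  have sup: "(\<integral>\<^sup>+x. (SUP i. U i) x \<partial>K) = (SUP i. integral\<^sup>N K (U i))"
    if "\<And>i. U i \<in> borel_measurable K" for K
    using nn_integral_monotone_convergence_SUP[OF seq.hyps(3) that]
    by (simp only: SUP_apply)
  show ?case
    unfolding sup[OF U(1)] sup[OF U(2)] sup[OF U(3)]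
    using seq.IH by (simp add: ennreal_SUP_add mono)
qed

text \<open>The difference \<open>N - M\<close> is a positive measure for which every \<open>h i\<close> has integral zero, so almost
  every point is a common zero of the \<open>h i\<close>. There is no such point, hence \<open>N - M = 0\<close>. With the
  single function \<open>h = 1\<close> this says that domination with equal total mass is equality.\<close>

lemma measure_eq_of_le_of_positive_integrals_eq:
  fixes h :: "'i \<Rightarrow> 'a \<Rightarrow> ennreal"
  assumes fin: "finite_measure M" "finite_measure N" and sets_eq: "sets M = sets N"
    and le: "\<And>A. A \<in> sets N \<Longrightarrow> emeasure M A \<le> emeasure N A"
    and I: "countable I"
    and h: "\<And>i. i \<in> I \<Longrightarrow> h i \<in> borel_measurable N"
    and integral_eq: "\<And>i. i \<in> I \<Longrightarrow> (\<integral>\<^sup>+x. h i x \<partial>M) = (\<integral>\<^sup>+x. h i x \<partial>N)"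
    and integral_fin: "\<And>i. i \<in> I \<Longrightarrow> (\<integral>\<^sup>+x. h i x \<partial>M) \<noteq> \<infinity>"
    and pos: "\<And>x. x \<in> space N \<Longrightarrow> \<exists>i\<in>I. h i x > 0"
  shows "M = N"
proof -
  define D where "D = diff_measure N M"
  have sets_D: "sets D = sets N" and space_D: "space D = space N"
    by (simp_all add: D_def)
  have D: "emeasure D A = emeasure N A - emeasure M A" if "A \<in> sets N" for A
    unfolding D_def using fin sets_eq le that by (intro emeasure_diff_measure) auto
  have split: "emeasure N A = emeasure M A + emeasure D A" if "A \<in> sets N" for A
    using le[OF that] by (simp add: D that add_diff_inverse_ennreal)
  have "AE x in D. h i x = 0" if i: "i \<in> I" for i
  proof -
    have "(\<integral>\<^sup>+x. h i x \<partial>M) + (\<integral>\<^sup>+x. h i x \<partial>D) = (\<integral>\<^sup>+x. h i x \<partial>M) + 0"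
      using nn_integral_add_measure[OF sets_eq sets_D split h[OF i]] integral_eq[OF i] by simp
    then have "(\<integral>\<^sup>+x. h i x \<partial>D) = 0"
      using integral_fin[OF i] by (simp add: ennreal_add_left_cancel)
    moreover have "h i \<in> borel_measurable D"
      using h[OF i] by (simp add: measurable_cong_sets[OF sets_D refl])
    ultimately show ?thesis
      by (simp add: nn_integral_0_iff_AE)
  qed
  then have "AE x in D. \<forall>i\<in>I. h i x = 0"
    using I by (simp add: AE_ball_countable)
  then have "AE x in D. False"
    by (rule AE_mp) (use pos space_D in \<open>auto intro!: AE_I2 simp: zero_less_iff_neq_zero\<close>)
  then have "emeasure D (space D) = 0"
    using AE_iff_measurable[of "space D" D "\<lambda>_. False"] by simp
  then have D0: "emeasure D A = 0" if "A \<in> sets N" for A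
    using emeasure_mono[of A "space D" D] sets.sets_into_space[OF that] that sets_D space_D
    by (simp add: sets_D)
  show ?thesis
    using split D0 sets_eq by (intro measure_eqI) auto
qed

section \<open>Flux of an invariant measure\<close>

lemma markov_semigroup_prob:
  assumes "markov_semigroup M P" "t \<ge> 0" "x \<in> space M"
  shows "prob_space (P t x)" "sets (P t x) = sets M"
  using assms measurable_space[of "P t" M "prob_algebra M" x]
  by (auto simp: markov_semigroup_def space_prob_algebra)

lemma markov_semigroup_measurable:
  assumes "markov_semigroup M P" "t \<ge> 0" "A \<in> sets M"
  shows "(\<lambda>x. emeasure (P t x) A) \<in> borel_measurable M"
proof -
  have "P t \<in> M \<rightarrow>\<^sub>M subprob_algebra M"
    using assms by (auto simp: markov_semigroup_def intro: measurable_prob_algebraD)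
  from measurable_emeasure_kernel[OF this assms(3)] show ?thesis .
qed

text \<open>The mass of \<open>Y\<close> is \<open>\<integral>\<^sub>Y P t x Y + \<integral>\<^sub>Y P t x C\<close>, as \<open>P t x\<close> has mass one, and by invariance it is
  also \<open>\<integral>\<^sub>Y P t x Y + \<integral>\<^sub>C P t x Y\<close>, where \<open>C\<close> is the complement of \<open>Y\<close>.\<close>

lemma invariant_flux_balance:
  assumes P: "markov_semigroup M P" and inv: "invariant_prob M P \<mu>"
    and t: "t \<ge> 0" and Y: "Y \<in> sets M"
  shows "(\<integral>\<^sup>+x. emeasure (P t x) Y * indicator (space M - Y) x \<partial>\<mu>)
       = (\<integral>\<^sup>+x. emeasure (P t x) (space M - Y) * indicator Y x \<partial>\<mu>)"
proof -
  let ?C = "space M - Y"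
  interpret prob_space \<mu>
    using inv by (simp add: invariant_prob_def)
  have sets_\<mu> [measurable_cong]: "sets \<mu> = sets M"
    using inv by (simp add: invariant_prob_def)
  have space_\<mu>: "space \<mu> = space M"
    by (rule sets_eq_imp_space_eq[OF sets_\<mu>])
  note Y [measurable]
  have [measurable]: "(\<lambda>x. emeasure (P t x) Y) \<in> borel_measurable M"
    "(\<lambda>x. emeasure (P t x) ?C) \<in> borel_measurable M"
    using markov_semigroup_measurable[OF P t] Y by auto
  let ?stay = "\<integral>\<^sup>+x. emeasure (P t x) Y * indicator Y x \<partial>\<mu>"
  have "emeasure \<mu> Y = (\<integral>\<^sup>+x. emeasure (P t x) Y \<partial>\<mu>)"
    using inv t Y by (simp add: invariant_prob_def)
  also have "\<dots> = (\<integral>\<^sup>+x. emeasure (P t x) Y * indicator Y x + emeasure (P t x) Y * indicator ?C x \<partial>\<mu>)"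
    by (intro nn_integral_cong) (auto simp: space_\<mu> indicator_def)
  also have "\<dots> = ?stay + (\<integral>\<^sup>+x. emeasure (P t x) Y * indicator ?C x \<partial>\<mu>)"
    by (intro nn_integral_add) measurable
  finally have 1: "emeasure \<mu> Y = ?stay + (\<integral>\<^sup>+x. emeasure (P t x) Y * indicator ?C x \<partial>\<mu>)" .
  have total: "emeasure (P t x) Y + emeasure (P t x) ?C = 1" if x: "x \<in> space M" for x
  proof -
    note Px = markov_semigroup_prob[OF P t x]
    have "emeasure (P t x) Y + emeasure (P t x) ?C = emeasure (P t x) (Y \<union> ?C)"
      using Y Px(2) by (intro plus_emeasure) auto
    also have "Y \<union> ?C = space (P t x)"
      using sets.sets_into_space[OF Y] sets_eq_imp_space_eq[OF Px(2)] by auto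
    finally show ?thesis
      using prob_space.emeasure_space_1[OF Px(1)] by simp
  qed
  have "emeasure \<mu> Y = (\<integral>\<^sup>+x. indicator Y x \<partial>\<mu>)"
    using Y sets_\<mu> by simp
  also have "\<dots> = (\<integral>\<^sup>+x. emeasure (P t x) Y * indicator Y x + emeasure (P t x) ?C * indicator Y x \<partial>\<mu>)"
    using total by (intro nn_integral_cong) (auto simp: space_\<mu> indicator_def)
  also have "\<dots> = ?stay + (\<integral>\<^sup>+x. emeasure (P t x) ?C * indicator Y x \<partial>\<mu>)"
    by (intro nn_integral_add) measurable
  finally have 2: "emeasure \<mu> Y = ?stay + (\<integral>\<^sup>+x. emeasure (P t x) ?C * indicator Y x \<partial>\<mu>)" .
  have "?stay \<noteq> \<infinity>"
    using 1 emeasure_finite[of Y] by (auto simp: top_unique)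
  with 1 2 show ?thesis
    by (simp add: ennreal_add_left_cancel)
qed

lemma nn_integral_indicator_mono_measure:
  assumes sets_M: "sets M = sets N" and Y: "Y \<in> sets N"
    and le: "\<And>A. A \<in> sets N \<Longrightarrow> A \<subseteq> Y \<Longrightarrow> emeasure M A \<le> emeasure N A"
    and h: "h \<in> borel_measurable N"
  shows "(\<integral>\<^sup>+x. h x * indicator Y x \<partial>M) \<le> (\<integral>\<^sup>+x. h x * indicator Y x \<partial>N)"
proof -
  have hM: "h \<in> borel_measurable M" and YM: "Y \<in> sets M"
    using h Y sets_M by (simp_all add: measurable_cong_sets[OF sets_M refl])
  have "emeasure (density M (indicator Y)) A \<le> emeasure (density N (indicator Y)) A" for A
  proof (cases "A \<in> sets N")
    case True
    then show ?thesis
      using le[of "Y \<inter> A"] Y YM sets_M by (simp add: emeasure_restricted)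
  qed (simp add: sets_M emeasure_notin_sets)
  then have "density M (indicator Y) \<le> density N (indicator Y)"
    using sets_M by (subst le_measure) (auto simp: le_fun_def)
  then have "(\<integral>\<^sup>+x. h x \<partial>density M (indicator Y)) \<le> (\<integral>\<^sup>+x. h x \<partial>density N (indicator Y))"
    using sets_M by (intro nn_integral_mono_measure) auto
  then show ?thesis
    using h hM Y YM by (simp add: nn_integral_density mult.commute)
qed

text \<open>By flux balance, the flux into \<open>Y\<close> is also the flux out of \<open>Y\<close>. The domination on the complement
  of \<open>Y\<close> compares the fluxes into \<open>Y\<close> in one direction, and the domination on \<open>Y\<close> compares the fluxes
  out of \<open>Y\<close> in the other.\<close>

lemma flux_into_dominating_set_eq:
  assumes P: "markov_semigroup M P"
    and \<mu>: "invariant_prob M P \<mu>" and \<nu>: "invariant_prob M P \<nu>"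
    and t: "t \<ge> 0" and Y: "Y \<in> sets M"
    and on: "\<And>A. A \<in> sets M \<Longrightarrow> A \<subseteq> Y \<Longrightarrow> emeasure \<nu> A \<le> emeasure \<mu> A"
    and off: "\<And>A. A \<in> sets M \<Longrightarrow> A \<subseteq> space M - Y \<Longrightarrow> emeasure \<mu> A \<le> emeasure \<nu> A"
  shows "(\<integral>\<^sup>+x. emeasure (P t x) Y * indicator (space M - Y) x \<partial>\<mu>)
       = (\<integral>\<^sup>+x. emeasure (P t x) Y * indicator (space M - Y) x \<partial>\<nu>)"
proof (rule antisym)
  have sets: "sets \<mu> = sets M" "sets \<nu> = sets M"
    using \<mu> \<nu> by (auto simp: invariant_prob_def)
  have meas: "(\<lambda>x. emeasure (P t x) A) \<in> borel_measurable \<mu>"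
    "(\<lambda>x. emeasure (P t x) A) \<in> borel_measurable \<nu>" if "A \<in> sets M" for A
    using markov_semigroup_measurable[OF P t that] sets by (simp_all cong: measurable_cong_sets)
  show "(\<integral>\<^sup>+x. emeasure (P t x) Y * indicator (space M - Y) x \<partial>\<mu>)
      \<le> (\<integral>\<^sup>+x. emeasure (P t x) Y * indicator (space M - Y) x \<partial>\<nu>)"
    using Y sets off meas by (intro nn_integral_indicator_mono_measure) auto
  have "(\<integral>\<^sup>+x. emeasure (P t x) (space M - Y) * indicator Y x \<partial>\<nu>)
      \<le> (\<integral>\<^sup>+x. emeasure (P t x) (space M - Y) * indicator Y x \<partial>\<mu>)"
    using Y sets on meas by (intro nn_integral_indicator_mono_measure) auto
  then show "(\<integral>\<^sup>+x. emeasure (P t x) Y * indicator (space M - Y) x \<partial>\<nu>)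
      \<le> (\<integral>\<^sup>+x. emeasure (P t x) Y * indicator (space M - Y) x \<partial>\<mu>)"
    by (simp only: invariant_flux_balance[OF P \<mu> t Y] invariant_flux_balance[OF P \<nu> t Y])
qed

section \<open>Uniqueness\<close>

text \<open>Here \<open>Q\<close> is a countable set of times, because exceptional null sets, one for each time, have to be
  collected. The flux identity gives equality on the complement of \<open>Y\<close>, hence equal mass of
  \<open>Y\<close>; domination then gives equality on \<open>Y\<close>.\<close>

lemma invariant_prob_eq_of_accessible_dominating_set:
  assumes P: "markov_semigroup M P"
    and \<mu>: "invariant_prob M P \<mu>" and \<nu>: "invariant_prob M P \<nu>"
    and Y: "Y \<in> sets M"
    and on: "\<And>A. A \<in> sets M \<Longrightarrow> A \<subseteq> Y \<Longrightarrow> emeasure \<nu> A \<le> emeasure \<mu> A"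
    and off: "\<And>A. A \<in> sets M \<Longrightarrow> A \<subseteq> space M - Y \<Longrightarrow> emeasure \<mu> A \<le> emeasure \<nu> A"
    and Q: "countable Q" "\<And>q. q \<in> Q \<Longrightarrow> q \<ge> 0"
    and access: "\<And>x. x \<in> space M \<Longrightarrow> \<exists>q\<in>Q. emeasure (P q x) Y > 0"
  shows "\<mu> = \<nu>"
proof -
  let ?C = "space M - Y"
  interpret \<mu>: prob_space \<mu> using \<mu> by (simp add: invariant_prob_def)
  interpret \<nu>: prob_space \<nu> using \<nu> by (simp add: invariant_prob_def)
  have sets: "sets \<mu> = sets M" "sets \<nu> = sets M"
    using \<mu> \<nu> by (auto simp: invariant_prob_def)
  note space = sets[THEN sets_eq_imp_space_eq]
  have C: "?C \<in> sets M" using Y by auto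
  note fin = \<mu>.finite_measure_restricted \<nu>.finite_measure_restricted
  have meas: "(\<lambda>x. emeasure (P q x) Y) \<in> borel_measurable \<mu>"
    "(\<lambda>x. emeasure (P q x) Y) \<in> borel_measurable \<nu>" if "q \<in> Q" for q
    using markov_semigroup_measurable[OF P Q(2)[OF that] Y] sets
    by (simp_all cong: measurable_cong_sets)
  have flux: "(\<integral>\<^sup>+x. emeasure (P q x) Y \<partial>density K (indicator ?C))
      = (\<integral>\<^sup>+x. emeasure (P q x) Y * indicator ?C x \<partial>K)"
    if "(\<lambda>x. emeasure (P q x) Y) \<in> borel_measurable K" "sets K = sets M" for q K
    using that C by (simp add: nn_integral_density mult.commute)
  have flux_finite: "(\<integral>\<^sup>+x. emeasure (P q x) Y * indicator ?C x \<partial>\<mu>) \<noteq> \<infinity>" if "q \<in> Q" for q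
  proof -
    have "emeasure (P q x) Y * indicator ?C x \<le> 1" if "x \<in> space \<mu>" for x
      using prob_space.emeasure_le_1[OF markov_semigroup_prob(1)[OF P Q(2)[OF \<open>q \<in> Q\<close>], of x], of Y] that space
      by (simp add: indicator_def)
    then have "(\<integral>\<^sup>+x. emeasure (P q x) Y * indicator ?C x \<partial>\<mu>) \<le> (\<integral>\<^sup>+x. 1 \<partial>\<mu>)"
      by (intro nn_integral_mono) auto
    also have "\<dots> = 1"
      using \<mu>.emeasure_space_1 by simp
    finally show ?thesis
      by (auto simp: top_unique)
  qed
  have "density \<mu> (indicator ?C) = density \<nu> (indicator ?C)"
  proof (rule measure_eq_of_le_of_positive_integrals_eq[where I = Q and h = "\<lambda>q x. emeasure (P q x) Y"])
    fix q assume q: "q \<in> Q"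
    show "(\<integral>\<^sup>+x. emeasure (P q x) Y \<partial>density \<mu> (indicator ?C))
        = (\<integral>\<^sup>+x. emeasure (P q x) Y \<partial>density \<nu> (indicator ?C))"
      unfolding flux[OF meas(1)[OF q] sets(1)] flux[OF meas(2)[OF q] sets(2)]
      by (rule flux_into_dominating_set_eq[OF P \<mu> \<nu> Q(2)[OF q] Y on off])
    show "(\<integral>\<^sup>+x. emeasure (P q x) Y \<partial>density \<mu> (indicator ?C)) \<noteq> \<infinity>"
      unfolding flux[OF meas(1)[OF q] sets(1)] by (rule flux_finite[OF q])
  next
    show "finite_measure (density \<mu> (indicator ?C))" "finite_measure (density \<nu> (indicator ?C))"
      using fin C sets by simp_all
    show "emeasure (density \<mu> (indicator ?C)) A \<le> emeasure (density \<nu> (indicator ?C)) A"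
      if "A \<in> sets (density \<nu> (indicator ?C))" for A
      using off[of "?C \<inter> A"] that C sets by (simp add: emeasure_restricted Int_lower1 sets.Int)
    show "\<exists>q\<in>Q. emeasure (P q x) Y > 0" if "x \<in> space (density \<nu> (indicator ?C))" for x
      using access that space by simp
  qed (use sets Q(1) meas in simp_all)
  then have eq_C: "emeasure \<mu> (?C \<inter> A) = emeasure \<nu> (?C \<inter> A)" if "A \<in> sets M" for A
    using emeasure_restricted[of ?C _ A] C that sets by metis
  have "measure \<mu> ?C = measure \<nu> ?C"
    using eq_C[of ?C] C by (simp add: measure_def)
  then have "measure \<mu> Y = measure \<nu> Y"
    using \<mu>.prob_compl[of Y] \<nu>.prob_compl[of Y] Y sets space by simp
  then have mass_Y: "emeasure \<mu> Y = emeasure \<nu> Y"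
    by (simp add: \<mu>.emeasure_eq_measure \<nu>.emeasure_eq_measure)
  have "density \<nu> (indicator Y) = density \<mu> (indicator Y)"
  proof (rule measure_eq_of_le_of_positive_integrals_eq[where I = "{()}" and h = "\<lambda>_ _. 1"])
    show "finite_measure (density \<nu> (indicator Y))" "finite_measure (density \<mu> (indicator Y))"
      using fin Y sets by simp_all
    show "emeasure (density \<nu> (indicator Y)) A \<le> emeasure (density \<mu> (indicator Y)) A"
      if "A \<in> sets (density \<mu> (indicator Y))" for A
      using on[of "Y \<inter> A"] that Y sets by (simp add: emeasure_restricted Int_lower1 sets.Int)
    have total: "(\<integral>\<^sup>+x. 1 \<partial>density K (indicator Y)) = emeasure K Y" if "sets K = sets M" for K
      using that Y sets_eq_imp_space_eq[OF that]
      by (simp add: emeasure_restricted Int_absorb2 sets.sets_into_space)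
    show "(\<integral>\<^sup>+x. 1 \<partial>density \<nu> (indicator Y)) = (\<integral>\<^sup>+x. 1 \<partial>density \<mu> (indicator Y))"
      "(\<integral>\<^sup>+x. 1 \<partial>density \<nu> (indicator Y)) \<noteq> \<infinity>"
      using mass_Y by (simp_all only: total sets, simp)
  qed (use sets in simp_all)
  then have eq_Y: "emeasure \<mu> (Y \<inter> A) = emeasure \<nu> (Y \<inter> A)" if "A \<in> sets M" for A
    using emeasure_restricted[of Y _ A] Y that sets by metis
  show ?thesis
  proof (rule measure_eqI)
    fix A assume "A \<in> sets \<mu>"
    then have A: "A \<in> sets M" using sets by simp
    then have split: "(Y \<inter> A) \<union> (?C \<inter> A) = A"
      using sets.sets_into_space[OF A] by auto
    have "emeasure K A = emeasure K (Y \<inter> A) + emeasure K (?C \<inter> A)" if "sets K = sets M" for K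
      using A Y C that by (subst plus_emeasure) (auto simp: split)
    then show "emeasure \<mu> A = emeasure \<nu> A"
      using eq_C[OF A] eq_Y[OF A] sets by simp
  qed (simp add: sets)
qed

lemma positive_at_rational_of_right_continuous:
  fixes f :: "real \<Rightarrow> real"
  assumes "continuous (at_right t) f" "f t > 0"
  shows "\<exists>q\<in>\<rat>. q > t \<and> f q > 0"
proof -
  have "eventually (\<lambda>s. f s > 0) (at_right t)"
    using assms by (auto simp: continuous_within intro: order_tendstoD)
  then obtain b where b: "b > t" "\<And>s. t < s \<Longrightarrow> s < b \<Longrightarrow> f s > 0"
    by (auto simp: eventually_at_right[of t "t + 1"])
  with Rats_dense_in_real[of t b] show ?thesis by blast
qed

theorem corollary3p9:
  fixes M :: "'a measure" and P :: "real \<Rightarrow> 'a \<Rightarrow> 'a measure"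
  assumes "standard_borel M"
    and "markov_semigroup M P"
    and "\<exists>\<mu>. invariant_prob M P \<mu>"
    and "psi_irreducible M P"
    and "\<And>x A t. x \<in> space M \<Longrightarrow> A \<in> sets M \<Longrightarrow> t > 0 \<Longrightarrow>
           continuous (at_right t) (\<lambda>s. measure (P s x) A)"
  shows "\<exists>!\<mu>. invariant_prob M P \<mu>"
proof -
  note P = assms(2)
  obtain \<psi> where sets_\<psi>: "sets \<psi> = sets M" and \<psi>_nonzero: "emeasure \<psi> (space M) \<noteq> 0"
    and irreducible: "\<And>A x. A \<in> sets M \<Longrightarrow> emeasure \<psi> A > 0 \<Longrightarrow> x \<in> space M \<Longrightarrow>
        \<exists>t>0. emeasure (P t x) A > 0"
    using assms(4) unfolding psi_irreducible_def by blast
  define Q where "Q = {q \<in> \<rat>. q > (0::real)}"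
  have Q: "countable Q" "\<And>q. q \<in> Q \<Longrightarrow> q \<ge> 0"
    by (auto simp: Q_def countable_rat intro: countable_subset[OF _ countable_rat])
  have rational_access: "\<exists>q\<in>Q. emeasure (P q x) A > 0"
    if A: "A \<in> sets M" "emeasure \<psi> A > 0" and x: "x \<in> space M" for A x
  proof -
    have P_measure: "emeasure (P t x) A = ennreal (measure (P t x) A)" if "t > 0" for t
      using markov_semigroup_prob(1)[OF P _ x, of t] that
      by (simp add: prob_space.finite_measure finite_measure.emeasure_eq_measure)
    obtain t where t: "t > 0" "emeasure (P t x) A > 0"
      using irreducible[OF A x] by blast
    then have "measure (P t x) A > 0"
      by (simp add: P_measure)
    from positive_at_rational_of_right_continuous[OF assms(5)[OF x A(1) t(1)] this]
    obtain q where "q \<in> \<rat>" "q > t" "measure (P q x) A > 0" by blast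
    with t show ?thesis
      by (intro bexI[of _ q]) (auto simp: P_measure Q_def)
  qed
  have unique: "\<mu> = \<nu>" if \<mu>: "invariant_prob M P \<mu>" and \<nu>: "invariant_prob M P \<nu>" for \<mu> \<nu>
  proof -
    have sets: "sets \<mu> = sets M" "sets \<nu> = sets M"
      and "finite_measure \<mu>" "finite_measure \<nu>"
      using \<mu> \<nu> by (auto simp: invariant_prob_def prob_space.finite_measure)
    then obtain Y where Y: "Y \<in> sets M"
      and on: "\<And>A. A \<in> sets M \<Longrightarrow> A \<subseteq> Y \<Longrightarrow> emeasure \<nu> A \<le> emeasure \<mu> A"
      and off: "\<And>A. A \<in> sets M \<Longrightarrow> A \<inter> Y = {} \<Longrightarrow> emeasure \<mu> A \<le> emeasure \<nu> A"
      using finite_unsigned_Hahn_decomposition[of \<mu> \<nu>] by auto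
    let ?C = "space M - Y"
    have C: "?C \<in> sets M" and Y_C: "space M - ?C = Y" "Y \<union> ?C = space M"
      using Y sets.sets_into_space[OF Y] by auto
    have "emeasure \<psi> (space M) = emeasure \<psi> Y + emeasure \<psi> ?C"
      using plus_emeasure[of Y \<psi> ?C] Y C sets_\<psi> Y_C by simp
    then consider "emeasure \<psi> Y > 0" | "emeasure \<psi> ?C > 0"
      using \<psi>_nonzero by (auto simp: zero_less_iff_neq_zero)
    then show ?thesis
    proof cases
      case 1
      show ?thesis
        by (rule invariant_prob_eq_of_accessible_dominating_set[OF P \<mu> \<nu> Y on _ Q rational_access[OF Y 1]])
          (auto intro: off)
    next
      case 2
      have "\<nu> = \<mu>"
        by (rule invariant_prob_eq_of_accessible_dominating_set[OF P \<nu> \<mu> C _ _ Q rational_access[OF C 2]])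
          (auto simp: Y_C intro: on off)
      then show ?thesis ..
    qed
  qed
  show ?thesis
    using assms(3) unique by blast
qed

end
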